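(* For every $c\in(0,1)\cap\mathbb{Q}$ and every $\varphi\in\mathcal{L}_{KB}$: if $\mathsf{KB}\vdash\varphi$, then $\varphi^c$ is true at every world of every epistemic probability model.
   Context: Fix a set $\mathsf{Prop}$ of propositional letters. Language $\mathcal{L}_{KB}$: $\varphi::=\top\mid p\mid\neg\varphi\mid\varphi\wedge\varphi\mid K\varphi\mid B\varphi$ with Boolean abbreviations, $\check K:=\neg K\neg$, $\check B:=\neg B\neg$. Calculus $\mathsf{KB}$: axiom schemes (CL) classical tautologies; (KS5) the $\mathsf{S5}$ schemes for $K$; (BF) $\neg B\bot$; (N) $B\top$; (Ap) $B\varphi\to KB\varphi$; (An) $\neg B\varphi\to K\neg B\varphi$; (KBM) $K(\varphi\to\psi)\to(B\varphi\to B\psi)$; rules modus ponens and from $\varphi$ infer $K\varphi$. Epistemic probability model: $(W,R,V,P)$ with $W$ finite nonempty, $R$ an equivalence relation on $W$ (classes $[w]$), $V:W\to\wp(\mathsf{Prop})$, $P$ a probability measure on $\wp(W)$ with $P(\{w\})\neq0$ for all $w$; $P_w(X):=P(X\cap[w])/P([w])$. Probability language $\mathcal{L}$: formulas $\varphi::=\top\mid p\mid\neg\varphi\mid\varphi\wedge\varphi\mid t\geq0$, terms $t::=q\mid q\cdot P(\varphi)\mid t+t$ ($q\in\mathbb{Q}$), with linear-inequality abbreviations; truth $\models_p$ is standard for Boolean cases and $t\geq0$ holds at $w$ iff the value of $t$ computed with $P(\varphi)\mapsto P_w(\{u\mid u\models_p\varphi\})$ is $\geq0$. Translation $(\cdot)^c:\mathcal{L}_{KB}\to\mathcal{L}$: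 commutes with $\top,p,\neg,\wedge$; $(K\varphi)^c=(P(\varphi^c)=1)$; $(B\varphi)^c=(P(\varphi^c)>c)$. *)

theory Defs
  imports "HOL-Probability.Probability_Measure"
begin

text \<open>The set of propositional letters is the type \<open>'p\<close>.\<close>

datatype 'p kb_form =
    Top
  | Atom 'p
  | Neg "'p kb_form"
  | Conj "'p kb_form" "'p kb_form"
  | Know "'p kb_form"
  | Bel "'p kb_form"

abbreviation Bot :: "'p kb_form" where
  "Bot \<equiv> Neg Top"

abbreviation Imp :: "'p kb_form \<Rightarrow> 'p kb_form \<Rightarrow> 'p kb_form" where
  "Imp \<phi> \<psi> \<equiv> Neg (Conj \<phi> (Neg \<psi>))"

text \<open>A formula of the modal language is an instance of a classical tautology if it is true
  under every Boolean valuation, where letters and formulas \<open>Know \<phi>\<close>, \<open>Bel \<phi>\<close> are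
  valued arbitrarily.\<close>

primrec bool_val :: "('p kb_form \<Rightarrow> bool) \<Rightarrow> 'p kb_form \<Rightarrow> bool" where
  "bool_val v Top \<longleftrightarrow> True"
| "bool_val v (Atom p) \<longleftrightarrow> v (Atom p)"
| "bool_val v (Neg \<phi>) \<longleftrightarrow> \<not> bool_val v \<phi>"
| "bool_val v (Conj \<phi> \<psi>) \<longleftrightarrow> bool_val v \<phi> \<and> bool_val v \<psi>"
| "bool_val v (Know \<phi>) \<longleftrightarrow> v (Know \<phi>)"
| "bool_val v (Bel \<phi>) \<longleftrightarrow> v (Bel \<phi>)"

definition tautology :: "'p kb_form \<Rightarrow> bool" where
  "tautology \<phi> \<longleftrightarrow> (\<forall>v. bool_val v \<phi>)"

inductive KB_derivable :: "'p kb_form \<Rightarrow> bool" where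
  CL: "tautology \<phi> \<Longrightarrow> KB_derivable \<phi>"
| KS5_K: "KB_derivable (Imp (Know (Imp \<phi> \<psi>)) (Imp (Know \<phi>) (Know \<psi>)))"
| KS5_T: "KB_derivable (Imp (Know \<phi>) \<phi>)"
| KS5_4: "KB_derivable (Imp (Know \<phi>) (Know (Know \<phi>)))"
| KS5_5: "KB_derivable (Imp (Neg (Know \<phi>)) (Know (Neg (Know \<phi>))))"
| BF: "KB_derivable (Neg (Bel Bot))"
| N: "KB_derivable (Bel Top)"
| Ap: "KB_derivable (Imp (Bel \<phi>) (Know (Bel \<phi>)))"
| An: "KB_derivable (Imp (Neg (Bel \<phi>)) (Know (Neg (Bel \<phi>))))"
| KBM: "KB_derivable (Imp (Know (Imp \<phi> \<psi>)) (Imp (Bel \<phi>) (Bel \<psi>)))"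
| MP: "KB_derivable (Imp \<phi> \<psi>) \<Longrightarrow> KB_derivable \<phi> \<Longrightarrow> KB_derivable \<psi>"
| Nec: "KB_derivable \<phi> \<Longrightarrow> KB_derivable (Know \<phi>)"

datatype 'p prob_form =
    PTop
  | PAtom 'p
  | PNeg "'p prob_form"
  | PConj "'p prob_form" "'p prob_form"
  | GeZero "'p prob_term"
and 'p prob_term =
    Const rat
  | ScaledProb rat "'p prob_form"
  | Plus "'p prob_term" "'p prob_term"

text \<open>Terms have no primitive subtraction; the negative of a term is obtained by negating
  its coefficients.\<close>

primrec neg_term :: "'p prob_term \<Rightarrow> 'p prob_term" where
  "neg_term (Const q) = Const (- q)"
| "neg_term (ScaledProb q \<phi>) = ScaledProb (- q) \<phi>"
| "neg_term (Plus s t) = Plus (neg_term s) (neg_term t)"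

definition Geq :: "'p prob_term \<Rightarrow> 'p prob_term \<Rightarrow> 'p prob_form" where
  "Geq s t = GeZero (Plus s (neg_term t))"

definition Eq :: "'p prob_term \<Rightarrow> 'p prob_term \<Rightarrow> 'p prob_form" where
  "Eq s t = PConj (Geq s t) (Geq t s)"

definition Gt :: "'p prob_term \<Rightarrow> 'p prob_term \<Rightarrow> 'p prob_form" where
  "Gt s t = PNeg (Geq t s)"

abbreviation Prob :: "'p prob_form \<Rightarrow> 'p prob_term" where
  "Prob \<phi> \<equiv> ScaledProb 1 \<phi>"

record ('w, 'p) model =
  worlds :: "'w set"
  indist :: "('w \<times> 'w) set"
  val :: "'w \<Rightarrow> 'p set"
  msr :: "'w measure"

definition epistemic_prob_model :: "('w, 'p) model \<Rightarrow> bool" where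
  "epistemic_prob_model M \<longleftrightarrow>
     finite (worlds M) \<and> worlds M \<noteq> {} \<and>
     equiv (worlds M) (indist M) \<and>
     prob_space (msr M) \<and> space (msr M) = worlds M \<and> sets (msr M) = Pow (worlds M) \<and>
     (\<forall>w\<in>worlds M. measure (msr M) {w} \<noteq> 0)"

definition local_prob :: "('w, 'p) model \<Rightarrow> 'w \<Rightarrow> 'w set \<Rightarrow> real" where
  "local_prob M w X =
     measure (msr M) (X \<inter> indist M `` {w}) / measure (msr M) (indist M `` {w})"

primrec holds :: "('w, 'p) model \<Rightarrow> 'w \<Rightarrow> 'p prob_form \<Rightarrow> bool"
  and term_val :: "('w, 'p) model \<Rightarrow> 'w \<Rightarrow> 'p prob_term \<Rightarrow> real"
where
  "holds M w PTop \<longleftrightarrow> True"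
| "holds M w (PAtom p) \<longleftrightarrow> p \<in> val M w"
| "holds M w (PNeg \<phi>) \<longleftrightarrow> \<not> holds M w \<phi>"
| "holds M w (PConj \<phi> \<psi>) \<longleftrightarrow> holds M w \<phi> \<and> holds M w \<psi>"
| "holds M w (GeZero t) \<longleftrightarrow> term_val M w t \<ge> 0"
| "term_val M w (Const q) = real_of_rat q"
| "term_val M w (ScaledProb q \<phi>) =
     real_of_rat q * local_prob M w {u \<in> worlds M. holds M u \<phi>}"
| "term_val M w (Plus s t) = term_val M w s + term_val M w t"

primrec translate :: "rat \<Rightarrow> 'p kb_form \<Rightarrow> 'p prob_form" where
  "translate c Top = PTop"
| "translate c (Atom p) = PAtom p"
| "translate c (Neg \<phi>) = PNeg (translate c \<phi>)"
| "translate c (Conj \<phi> \<psi>) = PConj (translate c \<phi>) (translate c \<psi>)"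
| "translate c (Know \<phi>) = Eq (Prob (translate c \<phi>)) (Const 1)"
| "translate c (Bel \<phi>) = Gt (Prob (translate c \<phi>)) (Const c)"

end

theory Submission
  imports Defs
begin

text \<open>Since singletons have positive measure, a formula has local probability one at a world iff
  it is true throughout the equivalence class of that world. Hence \<open>Know\<close> is translated to the
  universal modality over the class, and \<open>Bel\<close> to a condition that depends on the class only
  and is monotone in its argument; all axioms follow from this.\<close>

lemma term_val_neg_term [simp]: "term_val M w (neg_term t) = - term_val M w t"
  \<comment> \<open>Terms and formulas are mutually recursive; \<open>neg_term\<close> leaves the
    formulas inside a term untouched, so their induction predicate is trivial.\<close>
  by (induction t rule: prob_term.induct[where ?P1.0 = "\<lambda>_. True"])
     (simp_all add: of_rat_minus)

lemma holds_Eq [simp]: "holds M w (Eq s t) \<longleftrightarrow> term_val M w s = term_val M w t"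
  by (auto simp: Eq_def Geq_def)

lemma holds_Gt [simp]: "holds M w (Gt s t) \<longleftrightarrow> term_val M w s > term_val M w t"
  by (auto simp: Gt_def Geq_def)

text \<open>Translation commutes with the Boolean connectives, so truth at \<open>w\<close> is
  itself one of the valuations over which \<open>tautology\<close> quantifies.\<close>

lemma bool_val_holds:
  "bool_val (\<lambda>\<psi>. holds M w (translate c \<psi>)) \<phi> \<longleftrightarrow> holds M w (translate c \<phi>)"
  by (induction \<phi>) auto

lemma holds_tautology: "tautology \<phi> \<Longrightarrow> holds M w (translate c \<phi>)"
  by (metis bool_val_holds tautology_def)

locale epistemic_model =
  fixes M :: "('w, 'p) model"
  assumes epistemic_prob_model: "epistemic_prob_model M"
begin

abbreviation cell :: "'w \<Rightarrow> 'w set" where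
  "cell w \<equiv> indist M `` {w}"

lemma finite_measure_msr: "finite_measure (msr M)"
  using epistemic_prob_model
  by (auto simp: epistemic_prob_model_def intro: prob_space.finite_measure)

lemma equiv_indist: "equiv (worlds M) (indist M)"
  using epistemic_prob_model by (simp add: epistemic_prob_model_def)

lemma sets_msr [simp]: "sets (msr M) = Pow (worlds M)"
  using epistemic_prob_model by (simp add: epistemic_prob_model_def)

lemma cell_subset: "cell w \<subseteq> worlds M"
  using equiv_indist equiv_type by blast

lemma in_cell_in_worlds: "u \<in> cell w \<Longrightarrow> u \<in> worlds M"
  using cell_subset by blast

lemma self_in_cell: "w \<in> worlds M \<Longrightarrow> w \<in> cell w"
  using equiv_class_self equiv_indist by fastforce

lemma cell_eq: "u \<in> cell w \<Longrightarrow> cell u = cell w"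
  by (metis Image_singleton_iff equiv_class_eq equiv_indist)

lemma measure_mono: "A \<subseteq> B \<Longrightarrow> B \<subseteq> worlds M \<Longrightarrow> measure (msr M) A \<le> measure (msr M) B"
  by (intro finite_measure.finite_measure_mono finite_measure_msr) auto

text \<open>Some point lies in \<open>B\<close> but not in \<open>A\<close>, and its singleton has
  nonzero measure.\<close>

lemma measure_strict_mono:
  assumes "A \<subset> B" and "B \<subseteq> worlds M"
  shows "measure (msr M) A < measure (msr M) B"
proof -
  obtain u where u: "u \<in> B" "u \<notin> A"
    using assms(1) by blast
  have "measure (msr M) {u} \<noteq> 0"
    using epistemic_prob_model u assms(2) by (auto simp: epistemic_prob_model_def)
  moreover have "measure (msr M) {u} \<le> measure (msr M) (B - A)"
    using u assms by (intro measure_mono) auto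
  moreover have "measure (msr M) (B - A) = measure (msr M) B - measure (msr M) A"
    using assms by (intro finite_measure.finite_measure_Diff finite_measure_msr) auto
  ultimately show ?thesis
    using measure_nonneg[of "msr M" "{u}"] by linarith
qed

lemma measure_cell_pos: "w \<in> worlds M \<Longrightarrow> 0 < measure (msr M) (cell w)"
  using measure_strict_mono[of "{}" "cell w"] self_in_cell cell_subset by auto

text \<open>If \<open>X\<close> missed a point of the cell, \<open>X \<inter> cell w\<close> would
  be a proper subset and so have strictly smaller measure than the cell.\<close>

lemma local_prob_eq_1_iff:
  assumes "w \<in> worlds M"
  shows "local_prob M w X = 1 \<longleftrightarrow> cell w \<subseteq> X"
proof
  assume "local_prob M w X = 1"
  then have "measure (msr M) (X \<inter> cell w) = measure (msr M) (cell w)"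
    using measure_cell_pos[OF assms] by (simp add: local_prob_def)
  then have "\<not> X \<inter> cell w \<subset> cell w"
    using measure_strict_mono[OF _ cell_subset] by (metis less_irrefl)
  then show "cell w \<subseteq> X" by blast
next
  assume "cell w \<subseteq> X"
  then show "local_prob M w X = 1"
    using measure_cell_pos[OF assms] by (simp add: local_prob_def Int_absorb1)
qed

lemma local_prob_mono:
  assumes "X \<inter> cell w \<subseteq> Y"
  shows "local_prob M w X \<le> local_prob M w Y"
  unfolding local_prob_def using assms cell_subset[of w]
  by (intro divide_right_mono measure_mono) auto

lemma local_prob_empty [simp]: "local_prob M w {} = 0"
  by (simp add: local_prob_def)

text \<open>Related worlds have the same cell. This yields both introspection axioms
  \<open>Ap\<close> and \<open>An\<close>.\<close>

lemma local_prob_cong: "u \<in> cell w \<Longrightarrow> local_prob M u X = local_prob M w X"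
  by (simp add: local_prob_def cell_eq)

text \<open>Below, this replaces the defining equation of \<open>translate\<close> for
  \<open>Know\<close> as simp rule, so that the S5 cases reduce to reasoning about cells.\<close>

lemma holds_Know_iff:
  assumes "w \<in> worlds M"
  shows "holds M w (translate c (Know \<phi>)) \<longleftrightarrow> (\<forall>u\<in>cell w. holds M u (translate c \<phi>))"
  using local_prob_eq_1_iff[OF assms] cell_subset[of w] by auto

declare holds_Know_iff [simp] and translate.simps(5) [simp del]

lemma holds_Bel_iff:
  "holds M w (translate c (Bel \<phi>)) \<longleftrightarrow>
     of_rat c < local_prob M w {u \<in> worlds M. holds M u (translate c \<phi>)}"
  by simp

text \<open>Local probability ignores points outside the cell, so inclusion of the truth sets within
  the cell suffices. This is the content of \<open>KBM\<close>.\<close>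

lemma holds_Bel_mono:
  assumes "\<forall>u\<in>cell w. holds M u (translate c \<phi>) \<longrightarrow> holds M u (translate c \<psi>)"
    and "holds M w (translate c (Bel \<phi>))"
  shows "holds M w (translate c (Bel \<psi>))"
  using assms(2) unfolding holds_Bel_iff
  by (rule less_le_trans) (use assms(1) in \<open>auto intro: local_prob_mono\<close>)

lemma KB_sound:
  assumes "0 < c" and "c < 1" and "KB_derivable \<phi>" and "w \<in> worlds M"
  shows "holds M w (translate c \<phi>)"
  using assms(3,4)
\<comment> \<open>The world must vary: in case \<open>Nec\<close> the premise is needed at every
  world of the cell.\<close>
proof (induction arbitrary: w rule: KB_derivable.induct)
  case (CL \<phi>)
  then show ?case by (simp add: holds_tautology)
next
  case (KS5_K \<phi> \<psi>)
  then show ?case by auto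
next
  case (KS5_T \<phi>)
  then show ?case using self_in_cell by auto
next
  case (KS5_4 \<phi>)
  \<comment> \<open>Keeping membership in the form \<open>u \<in> cell w\<close> lets
    \<open>cell_eq\<close> identify the two cells.\<close>
  then show ?case using in_cell_in_worlds cell_eq by (auto simp del: Image_singleton_iff)
next
  case (KS5_5 \<phi>)
  then show ?case using in_cell_in_worlds cell_eq by (auto simp del: Image_singleton_iff)
next
  case BF
  \<comment> \<open>The truth set of \<open>Bot\<close> is empty, and its probability 0 does not
    exceed \<open>c\<close>.\<close>
  then show ?case using assms(1) by simp
next
  case N
  \<comment> \<open>The truth set of \<open>Top\<close> is \<open>worlds M\<close>; its probability
    1 exceeds \<open>c\<close> since \<open>c < 1\<close>.\<close>
  moreover have "local_prob M w (worlds M) = 1"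
    using N local_prob_eq_1_iff cell_subset by blast
  ultimately show ?case using assms(2) by simp
next
  case (Ap \<phi>)
  then show ?case by (auto simp: local_prob_cong)
next
  case (An \<phi>)
  then show ?case by (auto simp: local_prob_cong)
next
  case (KBM \<phi> \<psi>)
  then show ?case using holds_Bel_mono[of w c \<phi> \<psi>] by auto
next
  case (MP \<phi> \<psi>)
  then show ?case by auto
next
  case (Nec \<phi>)
  then show ?case using in_cell_in_worlds by auto
qed

end

theorem mainTheorem8:
  fixes c :: rat
    and \<phi> :: "'p kb_form"
    and M :: "('w, 'p) model"
    and w :: 'w
  assumes "0 < c" and "c < 1"
    and "KB_derivable \<phi>"
    and "epistemic_prob_model M"
    and "w \<in> worlds M"
  shows "holds M w (translate c \<phi>)"
proof -
  interpret epistemic_model M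
    by standard fact
  show ?thesis
    using assms(1-3,5) by (rule KB_sound)
qed

end
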